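(* Let $\mathfrak{A}$ be a $C^*$-algebra, let $E$, $H$ and $K$ be Hilbert $\mathfrak{A}$-modules, and let $T\in\mathcal{L}(E,K)$ and $S\in\mathcal{L}(H,K)$. Then the following two statements are equivalent: (i) $TT^*\le SS^*$; (ii) $\Vert T^*x\Vert\le\Vert S^*x\Vert$ for all $x\in K$.
   Context: Hilbert $\mathfrak{A}$-modules are right modules over the (not necessarily unital) $C^*$-algebra $\mathfrak{A}$ with an $\mathfrak{A}$-valued inner product $\langle\cdot,\cdot\rangle$ that is conjugate-linear in the first and linear (over $\mathbb{C}$ and $\mathfrak{A}$) in the second variable, complete in the norm $\Vert x\Vert=\sqrt{\Vert\langle x,x\rangle\Vert}$. $\mathcal{L}(H,K)$ denotes the set of adjointable operators $T:H\to K$, i.e. those for which there is $T^*:K\to H$ with $\langle Tx,y\rangle=\langle x,T^*y\rangle$ for all $x\in H$, $y\in K$. $\mathcal{L}(K)=\mathcal{L}(K,K)$ is a $C^*$-algebra, and $\le$ denotes its usual order: $A\le B$ means $B-A$ is a positive element of $\mathcal{L}(K)$. *)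

theory Defs
  imports Complex_Main
begin

class complex_banach = banach +
  fixes scaleC :: "complex \<Rightarrow> 'a \<Rightarrow> 'a"  (infixr \<open>*\<^sub>C\<close> 75)
  assumes scaleC_add_right: "c *\<^sub>C (x + y) = c *\<^sub>C x + c *\<^sub>C y"
    and scaleC_add_left: "(c + d) *\<^sub>C x = c *\<^sub>C x + d *\<^sub>C x"
    and scaleC_scaleC: "c *\<^sub>C (d *\<^sub>C x) = (c * d) *\<^sub>C x"
    and scaleC_of_real: "complex_of_real r *\<^sub>C x = r *\<^sub>R x"
    and norm_scaleC: "norm (c *\<^sub>C x) = cmod c * norm x"

class cstar_algebra = complex_banach + real_normed_algebra +
  fixes star :: "'a \<Rightarrow> 'a"
  assumes mult_scaleC_left: "(c *\<^sub>C x) * y = c *\<^sub>C (x * y)"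
    and mult_scaleC_right: "x * (c *\<^sub>C y) = c *\<^sub>C (x * y)"
    and star_add: "star (x + y) = star x + star y"
    and star_scaleC: "star (c *\<^sub>C x) = cnj c *\<^sub>C star x"
    and star_mult: "star (x * y) = star y * star x"
    and star_star: "star (star x) = x"
    and cstar_identity: "norm (star x * x) = (norm x)\<^sup>2"

text \<open>
  The pair \<open>(a, c)\<close> stands for \<open>a + c \<cdot> 1\<close> in the unitization of the algebra.
\<close>

definition unitization_mult ::
    "'a::cstar_algebra \<times> complex \<Rightarrow> 'a \<times> complex \<Rightarrow> 'a \<times> complex" where
  "unitization_mult u v =
     (fst u * fst v + snd u *\<^sub>C fst v + snd v *\<^sub>C fst u, snd u * snd v)"

text \<open>
  As the algebra need not have a unit, the spectrum is always taken in the unitization.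
  For an algebra that does have a unit this adds at most the point 0 to the usual
  spectrum, which does not affect positivity.
\<close>

definition spectrum :: "'a::cstar_algebra \<Rightarrow> complex set" where
  "spectrum a = {c. \<not> (\<exists>v. unitization_mult (a, - c) v = (0, 1)
                          \<and> unitization_mult v (a, - c) = (0, 1))}"

definition positive :: "'a::cstar_algebra \<Rightarrow> bool" where
  "positive a \<longleftrightarrow> star a = a \<and> spectrum a \<subseteq> complex_of_real ` {0..}"

text \<open>
  The class \<open>complex_banach\<close> provides a complete norm on the module; \<open>norm_eq\<close>
  says that it is the one coming from the inner product, so in particular the inner product
  is definite.
\<close>

locale hilbert_module =
  fixes act :: "'h::complex_banach \<Rightarrow> 'a::cstar_algebra \<Rightarrow> 'h"
    and ip :: "'h \<Rightarrow> 'h \<Rightarrow> 'a"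
  assumes act_add_left: "act (x + y) a = act x a + act y a"
    and act_add_right: "act x (a + b) = act x a + act x b"
    and act_mult: "act x (a * b) = act (act x a) b"
    and act_scaleC_left: "act (c *\<^sub>C x) a = c *\<^sub>C act x a"
    and act_scaleC_right: "act x (c *\<^sub>C a) = c *\<^sub>C act x a"
    and ip_add_right: "ip x (y + z) = ip x y + ip x z"
    and ip_scaleC_right: "ip x (c *\<^sub>C y) = c *\<^sub>C ip x y"
    and ip_act_right: "ip x (act y a) = ip x y * a"
    and ip_star: "star (ip x y) = ip y x"
    and ip_positive: "positive (ip x x)"
    and norm_eq: "norm x = sqrt (norm (ip x x))"

text \<open>
  Adjointability and adjoints depend on the two modules only through their inner products
  \<open>ipH\<close> and \<open>ipK\<close>; linearity and boundedness are automatic.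
\<close>

definition is_adjoint :: "('h \<Rightarrow> 'h \<Rightarrow> 'a) \<Rightarrow> ('k \<Rightarrow> 'k \<Rightarrow> 'a) \<Rightarrow>
    ('h \<Rightarrow> 'k) \<Rightarrow> ('k \<Rightarrow> 'h) \<Rightarrow> bool" where
  "is_adjoint ipH ipK T R \<longleftrightarrow> (\<forall>x y. ipK (T x) y = ipH x (R y))"

definition adjointables :: "('h \<Rightarrow> 'h \<Rightarrow> 'a) \<Rightarrow> ('k \<Rightarrow> 'k \<Rightarrow> 'a) \<Rightarrow>
    ('h \<Rightarrow> 'k) set" where
  "adjointables ipH ipK = {T. \<exists>R. is_adjoint ipH ipK T R}"

definition adj :: "('h \<Rightarrow> 'h \<Rightarrow> 'a) \<Rightarrow> ('k \<Rightarrow> 'k \<Rightarrow> 'a) \<Rightarrow>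
    ('h \<Rightarrow> 'k) \<Rightarrow> 'k \<Rightarrow> 'h" where
  "adj ipH ipK T = (THE R. is_adjoint ipH ipK T R)"

definition op_spectrum :: "('k::complex_banach \<Rightarrow> 'k \<Rightarrow> 'a) \<Rightarrow> ('k \<Rightarrow> 'k) \<Rightarrow> complex set" where
  "op_spectrum ip A = {c. \<not> (\<exists>B \<in> adjointables ip ip.
      B \<circ> (\<lambda>x. A x - c *\<^sub>C x) = id \<and> (\<lambda>x. A x - c *\<^sub>C x) \<circ> B = id)}"

definition op_positive :: "('k::complex_banach \<Rightarrow> 'k \<Rightarrow> 'a) \<Rightarrow> ('k \<Rightarrow> 'k) \<Rightarrow> bool" where
  "op_positive ip A \<longleftrightarrow> A \<in> adjointables ip ip \<and> adj ip ip A = A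
     \<and> op_spectrum ip A \<subseteq> complex_of_real ` {0..}"

definition op_le :: "('k::complex_banach \<Rightarrow> 'k \<Rightarrow> 'a) \<Rightarrow> ('k \<Rightarrow> 'k) \<Rightarrow> ('k \<Rightarrow> 'k) \<Rightarrow> bool" where
  "op_le ip A B \<longleftrightarrow> op_positive ip (\<lambda>x. B x - A x)"

end

theory Submission
  imports Defs "HOL-Analysis.Operator_Norm" "HOL-Analysis.Urysohn"
begin

text \<open>
  Let \<open>D = S S\<^sup>* - T T\<^sup>*\<close>. The link between the two statements is the element
  \<open>\<langle>x, D x\<rangle> = \<langle>S\<^sup>* x, S\<^sup>* x\<rangle> - \<langle>T\<^sup>* x, T\<^sup>* x\<rangle>\<close> of the algebra. If \<open>D\<close> is positive then so is this element,
  and the norm is monotone on positive elements of the algebra; this is the forward direction.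
  Conversely, the norm comparison for all \<open>x\<close> bounds \<open>D + l\<close> from below for every \<open>l > 0\<close>, and a
  self-adjoint operator with that property has its spectrum in the nonnegative half-line.

  No functional calculus is used. Its place is taken by one elementary fact
  (\<open>onorm_eq_0_of_bounded_below\<close>): if \<open>W\<close> is self-adjoint with norm \<open>m > 0\<close>, then \<open>m\<^sup>2 - W\<^sup>2\<close> is not bounded
  below. It rests on the inequality \<open>2p \<le> 1 + p\<^sup>2\<close> between norms (\<open>norm_one_plus_square\<close>), iterated over
  powers of two. Consequently an operator \<open>H\<close> for which all \<open>H + l\<close> are bounded below makes
  the norm of \<open>t - H\<close> at most \<open>t\<close>, once \<open>t\<close> is at least the norm of \<open>H\<close> (\<open>norm_reflection_le\<close>).

  The fact is applied twice. On the algebra, whose elements act by multiplication, it turns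
  positivity defined by the spectrum into the norm condition \<open>nonneg\<close>, which describes a closed convex
  cone and makes the norm monotone (\<open>norm_le_norm_add\<close>, \<open>norm_diff_le_norm_add\<close>); the Cauchy--Schwarz
  inequality on Hilbert modules follows. On a Hilbert module it turns positivity of \<open>D\<close> into
  contractivity of \<open>1 - D / t\<close>, and a sum-of-squares expansion then gives that \<open>\<langle>x, D x\<rangle>\<close> is
  nonnegative (\<open>nonneg_ip_of_op_positive\<close>). The opposite passage, from lower bounds to invertibility,
  moves a spectral parameter in from infinity (\<open>op_positive_of_bounded_below\<close>).
\<close>

section \<open>Scalars and the involution\<close>

lemma scaleC_minus_one: "(-1) *\<^sub>C x = - (x::'a::complex_banach)"
  using scaleC_of_real[of "-1" x] by simp

lemma scaleC_zero_left [simp]: "0 *\<^sub>C x = (0::'a::complex_banach)"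
  using scaleC_of_real[of 0 x] by simp

lemma scaleC_one [simp]: "1 *\<^sub>C x = (x::'a::complex_banach)"
  using scaleC_of_real[of 1 x] by simp

lemma scaleC_minus_left: "(- c) *\<^sub>C x = - (c *\<^sub>C (x::'a::complex_banach))"
  by (metis add_eq_0_iff add.right_inverse scaleC_add_left scaleC_zero_left)

lemma scaleC_diff_left: "(c - d) *\<^sub>C x = c *\<^sub>C x - d *\<^sub>C (x::'a::complex_banach)"
  by (metis diff_conv_add_uminus scaleC_add_left scaleC_minus_left)

lemma scaleC_zero_right [simp]: "c *\<^sub>C 0 = (0::'a::complex_banach)"
  by (metis add_cancel_right_right scaleC_add_right)

lemma scaleC_minus_right: "c *\<^sub>C (- x) = - (c *\<^sub>C (x::'a::complex_banach))"
  by (metis add_eq_0_iff add.right_inverse scaleC_add_right scaleC_zero_right)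

lemma scaleC_diff_right: "c *\<^sub>C (x - y) = c *\<^sub>C x - c *\<^sub>C (y::'a::complex_banach)"
  by (metis diff_conv_add_uminus scaleC_add_right scaleC_minus_right)

lemma norm_star [simp]: "norm (star a) = norm (a::'a::cstar_algebra)"
proof -
  have le: "norm b \<le> norm (star b)" for b :: 'a
  proof (cases "b = 0")
    case False
    have "norm b * norm b \<le> norm (star b) * norm b"
      using norm_mult_ineq[of "star b" b] by (simp add: cstar_identity power2_eq_square)
    with False show ?thesis by simp
  qed simp
  show ?thesis using le[of a] le[of "star a"] by (simp add: star_star)
qed

lemma star_scaleR: "star (r *\<^sub>R a) = r *\<^sub>R star (a::'a::cstar_algebra)"
  using star_scaleC[of "complex_of_real r" a] by (simp add: scaleC_of_real)

lemma star_minus: "star (- a) = - star (a::'a::cstar_algebra)"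
  using star_scaleR[of "-1" a] by simp

lemma star_diff: "star (a - b) = star a - star (b::'a::cstar_algebra)"
  by (metis diff_conv_add_uminus star_add star_minus)

section \<open>Modules with an algebra-valued inner product\<close>

text \<open>
  Two structures are instances: a Hilbert module, and the algebra itself with the inner product
  \<open>star a * b\<close>. The axioms hold trivially for the second, which positivity of \<open>ip x x\<close>
  would not: that \<open>star a * a\<close> is positive is a substantial theorem.
\<close>

locale ip_module =
  fixes ip :: "'e::complex_banach \<Rightarrow> 'e \<Rightarrow> 'a::cstar_algebra"
  assumes ip_add_right: "ip x (y + z) = ip x y + ip x z"
    and ip_scaleC_right: "ip x (c *\<^sub>C y) = c *\<^sub>C ip x y"
    and ip_star: "star (ip x y) = ip y x"
    and norm_ip_self: "norm (ip x x) = (norm x)\<^sup>2"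
begin

lemma ip_add_left: "ip (x + y) z = ip x z + ip y z"
  by (metis ip_add_right ip_star star_add)

lemma ip_scaleC_left: "ip (c *\<^sub>C x) y = cnj c *\<^sub>C ip x y"
  by (metis ip_scaleC_right ip_star star_scaleC)

lemma ip_scaleR_right: "ip x (r *\<^sub>R y) = r *\<^sub>R ip x y"
  by (metis ip_scaleC_right scaleC_of_real)

lemma ip_scaleR_left: "ip (r *\<^sub>R x) y = r *\<^sub>R ip x y"
  by (metis ip_scaleR_right ip_star star_scaleR)

lemma ip_minus_right: "ip x (- y) = - ip x y"
  using ip_scaleR_right[of x "-1" y] by simp

lemma ip_minus_left: "ip (- x) y = - ip x y"
  using ip_scaleR_left[of "-1" x y] by simp

lemma ip_diff_right: "ip x (y - z) = ip x y - ip x z"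
  by (metis diff_conv_add_uminus ip_add_right ip_minus_right)

lemma ip_diff_left: "ip (x - y) z = ip x z - ip y z"
  by (metis diff_conv_add_uminus ip_add_left ip_minus_left)

lemma ip_zero_right [simp]: "ip x 0 = 0"
  using ip_scaleR_right[of x 0 0] by simp

lemma ip_zero_left [simp]: "ip 0 x = 0"
  using ip_scaleR_left[of 0 0 x] by simp

lemmas ip_simps = ip_add_right ip_add_left ip_diff_right ip_diff_left ip_minus_right
  ip_minus_left ip_scaleR_right ip_scaleR_left ip_scaleC_right ip_scaleC_left

lemma ip_ext:
  assumes "\<And>z. ip z x = ip z y" shows "x = y"
proof -
  have "ip (x - y) (x - y) = 0" using assms by (simp add: ip_diff_right)
  then have "norm (x - y) = 0" using norm_ip_self[of "x - y"] by simp
  then show ?thesis by simp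
qed

end

lemma is_adjoint_sym:
  assumes "ip_module ipH" "ip_module ipK" "is_adjoint ipH ipK T R"
  shows "is_adjoint ipK ipH R T"
  unfolding is_adjoint_def
proof (intro allI)
  fix x y
  have "ipK (T y) x = ipH y (R x)" using assms(3) by (simp add: is_adjoint_def)
  then have "star (ipK (T y) x) = star (ipH y (R x))" by simp
  then show "ipH (R x) y = ipK x (T y)" by (simp only: ip_module.ip_star[OF assms(1)] ip_module.ip_star[OF assms(2)])
qed

lemma adj_eqI:
  assumes "ip_module ipH" "is_adjoint ipH ipK T R"
  shows "adj ipH ipK T = R"
  unfolding adj_def
proof (rule the_equality)
  fix R' assume "is_adjoint ipH ipK T R'"
  with assms(2) have "ipH x (R' y) = ipH x (R y)" for x y by (simp add: is_adjoint_def)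
  then show "R' = R" by (intro ext ip_module.ip_ext[OF assms(1)])
qed (rule assms)

lemma is_adjoint_add:
  assumes "ip_module ipH" "ip_module ipK" "is_adjoint ipH ipK T R"
  shows "T (x + y) = T x + T y"
proof (rule ip_module.ip_ext[OF assms(2)])
  interpret H: ip_module ipH by fact
  interpret K: ip_module ipK by fact
  have *: "ipK z (T w) = ipH (R z) w" for z w
    using is_adjoint_sym[OF assms] by (simp add: is_adjoint_def)
  fix z show "ipK z (T (x + y)) = ipK z (T x + T y)"
    by (simp add: * K.ip_add_right H.ip_add_right)
qed

lemma is_adjoint_scaleC:
  assumes "ip_module ipH" "ip_module ipK" "is_adjoint ipH ipK T R"
  shows "T (c *\<^sub>C x) = c *\<^sub>C T x"
proof (rule ip_module.ip_ext[OF assms(2)])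
  interpret H: ip_module ipH by fact
  interpret K: ip_module ipK by fact
  have *: "ipK z (T w) = ipH (R z) w" for z w
    using is_adjoint_sym[OF assms] by (simp add: is_adjoint_def)
  fix z show "ipK z (T (c *\<^sub>C x)) = ipK z (c *\<^sub>C T x)"
    by (simp add: * K.ip_scaleC_right H.ip_scaleC_right)
qed

lemma is_adjoint_scaleR:
  assumes "ip_module ipH" "ip_module ipK" "is_adjoint ipH ipK T R"
  shows "T (r *\<^sub>R x) = r *\<^sub>R T x"
  using is_adjoint_scaleC[OF assms, of "complex_of_real r" x] by (simp add: scaleC_of_real)

lemma is_adjoint_diff:
  assumes "ip_module ipH" "ip_module ipK" "is_adjoint ipH ipK T R"
  shows "T (x - y) = T x - T y"
  using is_adjoint_add[OF assms, of x "(-1) *\<^sub>R y"] is_adjoint_scaleR[OF assms, of "-1" y] by simp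

section \<open>Boundedness of adjointable operators\<close>

text \<open>
  The Banach--Steinhaus theorem. By Baire's theorem one of the closed sets on which the whole
  family is bounded by \<open>n\<close> contains a ball, and linearity moves that bound to the origin.
\<close>

lemma uniform_boundedness:
  fixes f :: "'i \<Rightarrow> 'b::banach \<Rightarrow> 'c::real_normed_vector"
  assumes lin: "\<And>i. i \<in> I \<Longrightarrow> bounded_linear (f i)"
    and pt: "\<And>x. \<exists>C. \<forall>i\<in>I. norm (f i x) \<le> C"
  shows "\<exists>C\<ge>0. \<forall>i\<in>I. \<forall>x. norm (f i x) \<le> C * norm x"
proof -
  define F where "F n = {x. \<forall>i\<in>I. norm (f i x) \<le> real n}" for n
  have cl: "closed (F n)" for n
  proof -
    have "F n = (\<Inter>i\<in>I. {x. norm (f i x) \<le> real n})" by (auto simp: F_def)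
    moreover have "closed {x. norm (f i x) \<le> real n}" if "i \<in> I" for i
      by (intro closed_Collect_le continuous_intros linear_continuous_on lin that)
    ultimately show ?thesis by auto
  qed
  have "(\<Union>n. F n) = UNIV"
  proof (intro set_eqI iffI UNIV_I)
    fix x
    obtain C where "\<forall>i\<in>I. norm (f i x) \<le> C" using pt by blast
    moreover obtain n where "C \<le> real n" using real_arch_simple by blast
    ultimately have "x \<in> F n" unfolding F_def by fastforce
    then show "x \<in> (\<Union>n. F n)" by blast
  qed
  have "\<exists>n. interior (F n) \<noteq> {}"
  proof (rule ccontr)
    assume "\<not> ?thesis"
    then have "euclidean interior_of \<Union>(range F) = ({}::'b set)"
      by (intro Baire_category_alt) (auto simp: cl completely_metrizable_space_euclidean)
    with \<open>(\<Union>n. F n) = UNIV\<close> show False by simp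
  qed
  then obtain n x0 where "x0 \<in> interior (F n)" by blast
  then obtain e where e: "e > 0" "cball x0 e \<subseteq> F n"
    by (meson mem_interior_cball)
  have "norm (f i x) \<le> 2 * real n / e * norm x" if i: "i \<in> I" for i x
  proof (cases "x = 0")
    case True
    then show ?thesis using linear_0[OF bounded_linear.linear[OF lin[OF i]]] by simp
  next
    case False
    interpret bounded_linear "f i" using lin i .
    define u where "u = (e / norm x) *\<^sub>R x"
    have "norm u = e" using False e by (simp add: u_def)
    then have "x0 + u \<in> F n" "x0 \<in> F n" using e by (auto simp: dist_norm subset_iff)
    then have "norm (f i (x0 + u)) \<le> n" "norm (f i x0) \<le> n" using i by (auto simp: F_def)
    moreover have "f i u = f i (x0 + u) - f i x0" by (simp add: add)
    ultimately have "norm (f i u) \<le> 2 * real n"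
      using norm_triangle_ineq4[of "f i (x0 + u)" "f i x0"] by simp
    moreover have "norm (f i u) = e / norm x * norm (f i x)" using e by (simp add: u_def scaleR)
    ultimately show ?thesis using False e by (simp add: field_simps)
  qed
  moreover have "2 * real n / e \<ge> 0" using e by simp
  ultimately show ?thesis by blast
qed

text \<open>
  The Cauchy--Schwarz inequality is an axiom here since its two instances have very different
  proofs: in the algebra it is submultiplicativity of the norm, while for a Hilbert module it
  rests on the order of the algebra, and that order is itself studied through the first instance.
\<close>

locale cs_module = ip_module ip for ip :: "'e::complex_banach \<Rightarrow> 'e \<Rightarrow> 'a::cstar_algebra" +
  assumes norm_ip_le: "norm (ip x y) \<le> norm x * norm y"

text \<open>
  The functionals \<open>x \<mapsto> \<langle>T y, x\<rangle> = \<langle>y, R x\<rangle>\<close>, with \<open>y\<close> in the unit ball, are bounded at each \<open>x\<close> by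
  the norm of \<open>R x\<close>, hence uniformly; at \<open>x = T y\<close> the uniform bound becomes a bound on \<open>T\<close>.
\<close>

lemma is_adjoint_bounded_linear:
  fixes T :: "'h::complex_banach \<Rightarrow> 'k::complex_banach" and ipH :: "'h \<Rightarrow> 'h \<Rightarrow> 'a::cstar_algebra"
  assumes "cs_module ipH" "cs_module ipK" and T: "is_adjoint ipH ipK T R"
  shows "bounded_linear T"
proof -
  interpret H: cs_module ipH by fact
  interpret K: cs_module ipK by fact
  note H = H.ip_module_axioms and K = K.ip_module_axioms
  have "\<exists>C\<ge>0. \<forall>y\<in>cball 0 1. \<forall>x. norm (ipK (T y) x) \<le> C * norm x"
  proof (rule uniform_boundedness)
    fix y show "bounded_linear (\<lambda>x. ipK (T y) x)"
    proof (rule bounded_linear_intro)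
      show "norm (ipK (T y) x) \<le> norm x * norm (T y)" for x
        using K.norm_ip_le[of "T y" x] by (simp add: mult.commute)
    qed (auto simp: K.ip_simps)
  next
    fix x
    have "norm (ipK (T y) x) \<le> norm (R x)" if "y \<in> cball 0 1" for y
    proof -
      have "norm (ipK (T y) x) = norm (ipH y (R x))" using T by (simp add: is_adjoint_def)
      also have "\<dots> \<le> norm y * norm (R x)" by (rule H.norm_ip_le)
      also have "\<dots> \<le> 1 * norm (R x)" using that by (intro mult_right_mono) auto
      finally show ?thesis by simp
    qed
    then show "\<exists>C. \<forall>y\<in>cball 0 1. norm (ipK (T y) x) \<le> C" by blast
  qed
  then obtain C where C: "C \<ge> 0" "\<And>y x. norm y \<le> 1 \<Longrightarrow> norm (ipK (T y) x) \<le> C * norm x"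
    by force
  have unit: "norm (T y) \<le> C" if "norm y \<le> 1" for y
  proof (cases "T y = 0")
    case False
    have "norm (T y) * norm (T y) \<le> C * norm (T y)"
      using C(2)[OF that, of "T y"] by (simp add: K.norm_ip_self power2_eq_square)
    with False show ?thesis by simp
  qed (use C in simp)
  have "norm (T y) \<le> norm y * C" for y
  proof (cases "y = 0")
    case True
    then show ?thesis using is_adjoint_scaleR[OF H K T, of 0 0] by simp
  next
    case False
    have "norm (T ((1 / norm y) *\<^sub>R y)) \<le> C" by (rule unit) (use False in simp)
    then show ?thesis using False by (simp add: is_adjoint_scaleR[OF H K T] field_simps)
  qed
  then show ?thesis
    by (intro bounded_linear_intro) (auto simp: is_adjoint_add[OF H K T] is_adjoint_scaleR[OF H K T])
qed

lemma funpow_funpow: "(f ^^ m) ((f ^^ n) x) = (f ^^ (m + n)) x"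
  by (simp add: funpow_add)

section \<open>The norm of a self-adjoint operator and its spectrum\<close>

context cs_module
begin

abbreviation selfadj :: "('e \<Rightarrow> 'e) \<Rightarrow> bool" where
  "selfadj W \<equiv> is_adjoint ip ip W W"

lemmas selfadj_linear =
  is_adjoint_add[OF ip_module_axioms ip_module_axioms]
  is_adjoint_diff[OF ip_module_axioms ip_module_axioms]
  is_adjoint_scaleR[OF ip_module_axioms ip_module_axioms]
  is_adjoint_scaleC[OF ip_module_axioms ip_module_axioms]

lemma selfadj_bounded_linear: "selfadj W \<Longrightarrow> bounded_linear W"
  by (rule is_adjoint_bounded_linear[OF cs_module_axioms cs_module_axioms])

lemma selfadj_funpow:
  assumes "selfadj W" shows "selfadj (W ^^ n)"
proof (induction n)
  case (Suc n)
  have "ip (W ((W ^^ n) x)) y = ip x ((W ^^ n) (W y))" for x y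
    using Suc assms by (metis is_adjoint_def)
  then show ?case by (simp add: is_adjoint_def funpow_swap1)
qed (simp add: is_adjoint_def)

lemma norm_square_le:
  assumes "selfadj W" shows "(norm (W x))\<^sup>2 \<le> norm x * norm (W (W x))"
  using norm_ip_le[of x "W (W x)"] norm_ip_self[of "W x"] assms by (simp add: is_adjoint_def)

text \<open>
  The two operators \<open>2P \<plusminus> \<i>(1 - P\<^sup>2)\<close> are adjoint to each other, commute, and have the product
  \<open>(1 + P\<^sup>2)\<^sup>2\<close>, so each of them maps \<open>x\<close> to a vector of the same norm as \<open>x + P (P x)\<close>. Their
  average is \<open>2P\<close>. This is the inequality \<open>2p \<le> 1 + p\<^sup>2\<close>, obtained without any functional calculus.
\<close>

lemma norm_one_plus_square:
  assumes "selfadj P" shows "2 * norm (P x) \<le> norm (x + P (P x))"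
proof -
  note [simp] = selfadj_linear[OF assms]
  have sa: "ip (P u) v = ip u (P v)" for u v using assms by (simp add: is_adjoint_def)
  define u v where "u = P x + P x" and "v = x - P (P x)"
  have uv: "ip u v = ip v u" and uu: "ip u u + ip v v = ip (x + P (P x)) (x + P (P x))"
    by (simp_all add: u_def v_def ip_simps sa)
  have "norm (u + c *\<^sub>C v) = norm (x + P (P x))" if "c = \<i> \<or> c = - \<i>" for c
  proof -
    have "ip (u + c *\<^sub>C v) (u + c *\<^sub>C v) = ip (x + P (P x)) (x + P (P x))"
      unfolding uu[symmetric] using that
      by (elim disjE; simp only: ip_add_left ip_add_right ip_scaleC_left ip_scaleC_right uv)
        (simp_all add: scaleC_add_right scaleC_diff_right scaleC_scaleC scaleC_minus_left scaleC_minus_one)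
    then have "(norm (u + c *\<^sub>C v))\<^sup>2 = (norm (x + P (P x)))\<^sup>2" by (metis norm_ip_self)
    then show ?thesis by simp
  qed
  from this[of \<i>] this[of "- \<i>"]
  have "norm ((u + \<i> *\<^sub>C v) + (u + (- \<i>) *\<^sub>C v)) \<le> 2 * norm (x + P (P x))"
    by (intro order_trans[OF norm_triangle_ineq]) simp
  moreover have "(u + \<i> *\<^sub>C v) + (u + (- \<i>) *\<^sub>C v) = 4 *\<^sub>R P x"
    using scaleR_left.add[of 2 2 "P x"] by (simp add: scaleC_minus_left u_def scaleR_2)
  ultimately show ?thesis by simp
qed

text \<open>
  The sum of \<open>W\<^sup>2\<^sup>k\<close> over \<open>k < n\<close> dominates \<open>n W\<^sup>n\<^sup>-\<^sup>1\<close>, its geometric mean. Doubling \<open>n\<close> multiplies the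
  sum by \<open>1 + P\<^sup>2\<close> with \<open>P = W\<^sup>n\<close>, which by the preceding inequality is worth a factor \<open>2P\<close>.
\<close>

lemma norm_even_power_sum_ge:
  assumes "selfadj W" and n: "n = 2 ^ j"
  shows "real n * norm ((W ^^ (n - 1)) y) \<le> norm (\<Sum>k<n. (W ^^ (2 * k)) y)"
  using n
proof (induction j arbitrary: n y)
  case 0
  then show ?case by simp
next
  case (Suc j)
  define m :: nat where "m = 2 ^ j"
  have m: "n = m + m" "m \<ge> 1" using Suc.prems by (auto simp: m_def)
  define A where "A y = (\<Sum>k<m. (W ^^ (2 * k)) y)" for y
  define P where "P = W ^^ m"
  have P: "selfadj P" unfolding P_def by (rule selfadj_funpow) fact
  interpret P: bounded_linear P by (rule selfadj_bounded_linear) fact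
  have comm: "P (A y) = A (P y)" for y
    unfolding A_def P.sum by (simp add: P_def funpow_funpow add.commute)
  have split: "(\<Sum>k<n. (W ^^ (2 * k)) y) = A y + P (P (A y))"
  proof -
    have "sum f {..<m + p} = sum f {..<m} + (\<Sum>k<p. f (m + k))" for f :: "nat \<Rightarrow> 'e" and p
      by (induction p) (auto simp: add.assoc)
    then have "(\<Sum>k<n. (W ^^ (2 * k)) y) = A y + (\<Sum>k<m. (W ^^ (2 * (m + k))) y)"
      unfolding A_def m by blast
    moreover have "(W ^^ (2 * (m + k))) y = P (P ((W ^^ (2 * k)) y))" for k
      by (simp add: P_def mult_2 funpow_funpow algebra_simps)
    ultimately show ?thesis by (simp add: A_def P.sum)
  qed
  have "real n * norm ((W ^^ (n - 1)) y) = 2 * (real m * norm ((W ^^ (m - 1)) (P y)))"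
  proof -
    have "n - 1 = m - 1 + m" using m by simp
    then show ?thesis by (simp add: P_def funpow_add m)
  qed
  also have "\<dots> \<le> 2 * norm (A (P y))" using Suc.IH[OF m_def, of "P y"] by (simp add: A_def)
  also have "\<dots> \<le> norm (A y + P (P (A y)))"
    using norm_one_plus_square[OF P, of "A y"] by (simp add: comm)
  finally show ?case by (simp add: split)
qed

text \<open>
  A self-adjoint operator has plus or minus its norm \<open>m\<close> as an approximate eigenvalue. Scale to \<open>m = 1\<close>,
  and suppose that \<open>1 - V\<^sup>2\<close> is bounded below. The sum \<open>y\<close> of \<open>V\<^sup>2\<^sup>k x\<close> over \<open>k < n\<close> telescopes under
  \<open>1 - V\<^sup>2\<close>, so the norm of \<open>y\<close> is bounded by a multiple of that of \<open>x\<close> independent of \<open>n\<close>; yet it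
  is at least \<open>n\<close> times the norm of \<open>V\<^sup>n\<^sup>-\<^sup>1 x\<close>. Hence some power \<open>V\<^sup>n\<close>, with \<open>n\<close> a power of two, has norm
  at most one half. Since squaring a self-adjoint operator squares its norm, taking square roots
  shows that \<open>V\<close> has norm less than 1, a contradiction.
\<close>

lemma onorm_eq_0_of_bounded_below:
  assumes W: "selfadj W" and \<delta>: "\<delta> > 0"
    and below: "\<And>x. \<delta> * norm x \<le> norm ((onorm W)\<^sup>2 *\<^sub>R x - W (W x))"
  shows "onorm W = 0"
proof (rule ccontr)
  define m where "m = onorm W"
  interpret W: bounded_linear W by (rule selfadj_bounded_linear) fact
  assume "onorm W \<noteq> 0"
  then have m: "m > 0" using onorm_pos_le[OF W.bounded_linear_axioms] by (simp add: m_def)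
  define V where "V x = (1 / m) *\<^sub>R W x" for x
  have V: "selfadj V"
    using W by (simp add: is_adjoint_def V_def ip_simps)
  interpret V: bounded_linear V by (rule selfadj_bounded_linear) fact
  have V_le: "norm (V x) \<le> norm x" for x
    using onorm[OF W.bounded_linear_axioms, of x] m by (simp add: V_def m_def field_simps)
  have pow_le: "norm ((V ^^ n) x) \<le> norm x" for n x
    by (induction n) (auto intro: order_trans[OF V_le])
  define C where "C = m\<^sup>2 / \<delta>"
  have C: "C > 0" "norm x \<le> C * norm (x - V (V x))" for x
  proof -
    have "m\<^sup>2 *\<^sub>R (x - V (V x)) = m\<^sup>2 *\<^sub>R x - W (W x)"
      using m by (simp add: V_def W.scaleR algebra_simps power2_eq_square)
    then have "m\<^sup>2 * norm (x - V (V x)) = norm (m\<^sup>2 *\<^sub>R x - W (W x))"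
      by (metis abs_of_nonneg norm_scaleR zero_le_power2)
    then show "norm x \<le> C * norm (x - V (V x))"
      using below[of x] \<delta> by (simp add: C_def m_def field_simps)
  qed (use m \<delta> in \<open>simp add: C_def\<close>)
  \<comment> \<open>The norm of \<open>V ^^ n\<close> turns out to be at most \<open>2 * C / n\<close>, so this \<open>j\<close> makes it at most one half.\<close>
  obtain j where j: "4 * C < 2 ^ j"
    using real_arch_pow[of 2 "4 * C"] by auto
  define n :: nat where "n = 2 ^ j"
  have half: "norm ((V ^^ n) x) \<le> 1/2 * norm x" for x
  proof -
    define y where "y = (\<Sum>k<n. (V ^^ (2 * k)) x)"
    have "y - V (V y) = (\<Sum>k<n. (V ^^ (2 * k)) x - (V ^^ (2 * Suc k)) x)"
      by (simp add: y_def V.sum sum_subtractf)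
    also have "\<dots> = x - (V ^^ (2 * n)) x"
      by (subst sum_lessThan_telescope'[of "\<lambda>k. (V ^^ (2 * k)) x"]) simp
    finally have "norm (y - V (V y)) \<le> norm x + norm ((V ^^ (2 * n)) x)"
      by (simp add: norm_triangle_ineq4)
    also have "\<dots> \<le> 2 * norm x" using pow_le[of "2 * n" x] by simp
    finally have "norm y \<le> C * (2 * norm x)"
      using C by (meson mult_left_mono less_imp_le order_trans)
    moreover have "real n * norm ((V ^^ (n - 1)) x) \<le> norm y"
      unfolding y_def by (rule norm_even_power_sum_ge[OF V n_def])
    moreover have "norm ((V ^^ n) x) \<le> norm ((V ^^ (n - 1)) x)"
      using V_le[of "(V ^^ (n - 1)) x"] funpow_funpow[of 1 V "n - 1" x] by (simp add: n_def)
    ultimately have "real n * norm ((V ^^ n) x) \<le> 2 * C * norm x"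
      using mult_left_mono[of "norm ((V ^^ n) x)" "norm ((V ^^ (n - 1)) x)" "real n"] by simp
    also have "\<dots> \<le> (real n / 2) * norm x"
      using j by (intro mult_right_mono) (auto simp: n_def)
    finally have "real n * norm ((V ^^ n) x) \<le> real n * (1/2 * norm x)" by simp
    then show ?thesis by (rule mult_left_le_imp_le) (simp add: n_def)
  qed
  \<comment> \<open>Square roots take the exponent from \<open>2 ^ j\<close>, halving it each time, down to 1.\<close>
  have descent: "\<exists>\<theta><1. \<theta> \<ge> 0 \<and> (\<forall>x. norm ((V ^^ (2 ^ (j - i))) x) \<le> \<theta> * norm x)" for i
  proof (induction i)
    case 0
    show ?case using half by (intro exI[of _ "1/2"]) (auto simp: n_def)
  next
    case (Suc i)
    show ?case
    proof (cases "i < j")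
      case True
      from Suc obtain \<theta> where \<theta>: "\<theta> < 1" "\<theta> \<ge> 0"
        "\<And>x. norm ((V ^^ (2 ^ (j - i))) x) \<le> \<theta> * norm x" by blast
      define P where "P = V ^^ (2 ^ (j - Suc i))"
      have P: "selfadj P" unfolding P_def by (rule selfadj_funpow[OF V])
      have e: "j - i = Suc (j - Suc i)" using True by simp
      have PP: "P (P x) = (V ^^ (2 ^ (j - i))) x" for x
        unfolding e by (simp add: P_def funpow_funpow mult_2)
      have "norm (P x) \<le> sqrt \<theta> * norm x" for x
      proof (rule power2_le_imp_le)
        have "(norm (P x))\<^sup>2 \<le> norm x * (\<theta> * norm x)"
          using norm_square_le[OF P, of x] \<theta>(3)[of x]
          by (simp add: PP) (meson mult_left_mono norm_ge_zero order_trans)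
        then show "(norm (P x))\<^sup>2 \<le> (sqrt \<theta> * norm x)\<^sup>2"
          using \<theta>(2) by (simp add: power_mult_distrib real_sqrt_pow2 algebra_simps power2_eq_square[of "norm x"])
      qed (use \<theta> in simp)
      then show ?thesis using \<theta> by (intro exI[of _ "sqrt \<theta>"]) (auto simp: P_def)
    next
      case False
      then have "j - Suc i = j - i" by simp
      with Suc show ?thesis by simp
    qed
  qed
  from descent[of j] obtain \<theta> where \<theta>: "\<theta> < 1" "\<And>x. norm (V x) \<le> \<theta> * norm x" "\<theta> \<ge> 0" by auto
  have "norm (W x) \<le> (m * \<theta>) * norm x" for x
    using \<theta>(2)[of x] m by (simp add: V_def field_simps)
  then have "m \<le> m * \<theta>" using m \<theta>(3) unfolding m_def[symmetric] by (subst m_def) (rule onorm_bound; simp)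
  with m \<theta>(1) show False by simp
qed

lemma onorm_eq_0_of_bounded_below_both:
  assumes W: "selfadj W" and "\<delta> > 0" "\<epsilon> > 0"
    and minus: "\<And>x. \<delta> * norm x \<le> norm (onorm W *\<^sub>R x - W x)"
    and plus: "\<And>x. \<epsilon> * norm x \<le> norm (onorm W *\<^sub>R x + W x)"
  shows "onorm W = 0"
proof (rule onorm_eq_0_of_bounded_below[OF W])
  show "\<delta> * \<epsilon> > 0" using assms by simp
  interpret W: bounded_linear W by (rule selfadj_bounded_linear) fact
  fix x
  let ?y = "onorm W *\<^sub>R x + W x"
  have "(onorm W)\<^sup>2 *\<^sub>R x - W (W x) = onorm W *\<^sub>R ?y - W ?y"
    by (simp add: W.add W.scaleR algebra_simps power2_eq_square)
  moreover have "\<delta> * (\<epsilon> * norm x) \<le> \<delta> * norm ?y"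
    using plus[of x] assms(2) by simp
  ultimately show "\<delta> * \<epsilon> * norm x \<le> norm ((onorm W)\<^sup>2 *\<^sub>R x - W (W x))"
    using minus[of ?y] by simp
qed

text \<open>
  Nonnegative spectrum bounds the norm of the reflected operator \<open>W = t - H\<close>. If \<open>m\<close>, the norm of
  \<open>W\<close>, exceeded \<open>t\<close>, then \<open>m - W = H + (m - t)\<close> would be bounded below by assumption and
  \<open>m + W = (m + t) - H\<close> because \<open>t\<close> dominates the norm of \<open>H\<close>.
\<close>

lemma norm_reflection_le:
  assumes H: "selfadj H" and t: "onorm H \<le> t"
    and below: "\<And>l. l > 0 \<Longrightarrow> \<exists>\<delta>>0. \<forall>x. \<delta> * norm x \<le> norm (H x + l *\<^sub>R x)"
  shows "norm (t *\<^sub>R x - H x) \<le> t * norm x"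
proof -
  define W where "W x = t *\<^sub>R x - H x" for x
  interpret H: bounded_linear H by (rule selfadj_bounded_linear) fact
  have W: "selfadj W" using H by (simp add: is_adjoint_def W_def ip_simps)
  interpret W: bounded_linear W by (rule selfadj_bounded_linear) fact
  have t0: "t \<ge> 0" using onorm_pos_le[OF H.bounded_linear_axioms] t by simp
  have "onorm W \<le> t"
  proof (rule ccontr)
    assume *: "\<not> onorm W \<le> t"
    then obtain \<delta> where \<delta>: "\<delta> > 0" "\<And>x. \<delta> * norm x \<le> norm (H x + (onorm W - t) *\<^sub>R x)"
      using below[of "onorm W - t"] by auto
    have "onorm W = 0"
    proof (rule onorm_eq_0_of_bounded_below_both[OF W \<delta>(1)])
      show "\<delta> * norm x \<le> norm (onorm W *\<^sub>R x - W x)" for x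
        using \<delta>(2)[of x] by (simp add: W_def algebra_simps)
      show "onorm W > 0" using * t0 by simp
      fix x
      have "norm (H x) \<le> t * norm x"
        using onorm[OF H.bounded_linear_axioms, of x] t mult_right_mono[OF t, of "norm x"] by simp
      moreover have "norm ((onorm W + t) *\<^sub>R x) = (onorm W + t) * norm x"
        using * t0 by simp
      ultimately have "onorm W * norm x \<le> norm ((onorm W + t) *\<^sub>R x - H x)"
        using norm_triangle_ineq2[of "(onorm W + t) *\<^sub>R x" "H x"] by (simp add: algebra_simps)
      then show "onorm W * norm x \<le> norm (onorm W *\<^sub>R x + W x)"
        by (simp add: W_def algebra_simps)
    qed
    with * t0 show False by simp
  qed
  then show ?thesis
    using onorm[OF W.bounded_linear_axioms, of x] mult_right_mono[of "onorm W" t "norm x"]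
    by (simp add: W_def)
qed

text \<open>
  The operator inequalities \<open>W \<le> \<rho>\<close> and \<open>- W \<le> \<rho>\<close>, expressed through norms, keep both \<open>m - W\<close> and
  \<open>m + W\<close> bounded below when \<open>m > \<rho>\<close>, so that the norm of \<open>W\<close> cannot be such an \<open>m\<close>.
\<close>

lemma norm_le_of_shifts:
  assumes W: "selfadj W" and "\<rho> \<ge> 0"
    and plus: "\<And>x. norm (s *\<^sub>R x + W x) \<le> (s + \<rho>) * norm x"
    and minus: "\<And>x. norm (t *\<^sub>R x - W x) \<le> (t + \<rho>) * norm x"
  shows "norm (W x) \<le> \<rho> * norm x"
proof -
  interpret W: bounded_linear W by (rule selfadj_bounded_linear) fact
  have "onorm W \<le> \<rho>"
  proof (rule ccontr)
    assume *: "\<not> onorm W \<le> \<rho>"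
    have "onorm W = 0"
    proof (rule onorm_eq_0_of_bounded_below_both[OF W])
      show "onorm W - \<rho> > 0" "onorm W - \<rho> > 0" using * by simp_all
      fix x :: 'e
      have shift: "(onorm W + r) * norm x \<le> norm ((onorm W + r) *\<^sub>R x)" for r :: real
        by (simp add: mult_right_mono)
      show "(onorm W - \<rho>) * norm x \<le> norm (onorm W *\<^sub>R x - W x)"
        using plus[of x] shift[of s]
          norm_triangle_ineq2[of "(onorm W + s) *\<^sub>R x" "s *\<^sub>R x + W x"]
        by (simp add: algebra_simps)
      show "(onorm W - \<rho>) * norm x \<le> norm (onorm W *\<^sub>R x + W x)"
        using minus[of x] shift[of t]
          norm_triangle_ineq2[of "(onorm W + t) *\<^sub>R x" "t *\<^sub>R x - W x"]
        by (simp add: algebra_simps)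
    qed
    with * assms(2) show False by simp
  qed
  then show ?thesis
    using onorm[OF W.bounded_linear_axioms, of x] mult_right_mono[of "onorm W" \<rho> "norm x"] by simp
qed

end

section \<open>Order and norm in the algebra\<close>

lemma cs_module_algebra: "cs_module (\<lambda>a b :: 'a::cstar_algebra. star a * b)"
proof
  show "norm (star x * y) \<le> norm x * norm y" for x y :: 'a
    using norm_mult_ineq[of "star x" y] by simp
qed (auto simp: distrib_left mult_scaleC_right star_mult star_star cstar_identity)

lemma selfadj_mult:
  assumes "star p = (p::'a::cstar_algebra)"
  shows "is_adjoint (\<lambda>a b. star a * b) (\<lambda>a b. star a * b) ((*) p) ((*) p)"
  using assms by (simp add: is_adjoint_def star_mult mult.assoc)

text \<open>
  In a unital \<open>C\<^sup>*\<close>-algebra a self-adjoint \<open>p\<close> is positive iff \<open>t - p\<close> has norm at most \<open>t\<close> for some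
  \<open>t\<close>. Letting \<open>t - p\<close> act on the algebra by multiplication makes this meaningful without a unit.
  In this form, sums of nonnegative elements are obviously nonnegative.
\<close>

definition nonneg :: "'a::cstar_algebra \<Rightarrow> bool" where
  "nonneg p \<longleftrightarrow> star p = p \<and> (\<exists>t. \<forall>b. norm (t *\<^sub>R b - p * b) \<le> t * norm b)"

lemma nonneg_star: "nonneg p \<Longrightarrow> star p = p"
  by (simp add: nonneg_def)

lemma nonneg_add:
  assumes "nonneg p" "nonneg q" shows "nonneg (p + q)"
proof -
  from assms obtain s t where st: "\<And>b. norm (s *\<^sub>R b - p * b) \<le> s * norm b"
    "\<And>b. norm (t *\<^sub>R b - q * b) \<le> t * norm b" by (auto simp: nonneg_def)
  have "norm ((s + t) *\<^sub>R b - (p + q) * b) \<le> (s + t) * norm b" for b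
    using norm_triangle_ineq[of "s *\<^sub>R b - p * b" "t *\<^sub>R b - q * b"] st[of b]
    by (simp add: algebra_simps)
  with assms show ?thesis by (auto simp: nonneg_def star_add)
qed

lemma nonneg_scaleR:
  assumes "nonneg p" "r \<ge> 0" shows "nonneg (r *\<^sub>R p)"
proof -
  from assms obtain t where t: "\<And>b. norm (t *\<^sub>R b - p * b) \<le> t * norm b"
    by (auto simp: nonneg_def)
  have "norm ((r * t) *\<^sub>R b - r *\<^sub>R p * b) \<le> r * t * norm b" for b
  proof -
    have "(r * t) *\<^sub>R b - r *\<^sub>R p * b = r *\<^sub>R (t *\<^sub>R b - p * b)"
      by (simp add: algebra_simps)
    then show ?thesis using t[of b] assms(2) by (simp add: mult.assoc mult_left_mono)
  qed
  with assms show ?thesis by (auto simp: nonneg_def star_scaleR)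
qed

lemma norm_diff_le_of_bounded_below:
  fixes p :: "'a::cstar_algebra"
  assumes "star p = p" "norm p \<le> t"
    and "\<And>l. l > 0 \<Longrightarrow> \<exists>\<delta>>0. \<forall>b. \<delta> * norm b \<le> norm (p * b + l *\<^sub>R b)"
  shows "norm (t *\<^sub>R b - p * b) \<le> t * norm b"
proof -
  interpret A: cs_module "\<lambda>a b :: 'a. star a * b" by (rule cs_module_algebra)
  have "onorm ((*) p) \<le> norm p" by (intro onorm_bound norm_mult_ineq norm_ge_zero)
  with assms show ?thesis by (intro A.norm_reflection_le selfadj_mult) auto
qed

text \<open>
  Any constant admitted by the definition makes \<open>p + l\<close> bounded below by \<open>l\<close>, hence every \<open>t\<close> from the
  norm of \<open>p\<close> on is admitted. One \<open>t\<close> thus serves a whole convergent sequence, so the cone is closed.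
\<close>

lemma nonneg_norm_le:
  assumes p: "nonneg p" "norm p \<le> t"
  shows "norm (t *\<^sub>R b - p * b) \<le> t * norm b"
proof (rule norm_diff_le_of_bounded_below)
  fix l :: real assume "l > 0"
  from p obtain s where s: "\<And>b. norm (s *\<^sub>R b - p * b) \<le> s * norm b"
    by (auto simp: nonneg_def)
  have "l * norm b \<le> norm (p * b + l *\<^sub>R b)" for b
  proof -
    have "(l + s) * norm b \<le> norm ((l + s) *\<^sub>R b)" by (simp add: mult_right_mono)
    then show ?thesis
      using norm_triangle_ineq2[of "(l + s) *\<^sub>R b" "s *\<^sub>R b - p * b"] s[of b]
      by (simp add: algebra_simps)
  qed
  then show "\<exists>\<delta>>0. \<forall>b. \<delta> * norm b \<le> norm (p * b + l *\<^sub>R b)" using \<open>l > 0\<close> by blast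
qed (use p in \<open>auto simp: nonneg_def\<close>)

lemma nonneg_tendsto:
  assumes p: "\<And>n. nonneg (p n)" and lim: "p \<longlonglongrightarrow> q"
  shows "nonneg q"
proof -
  have "bounded_linear (star :: 'a \<Rightarrow> 'a)"
    by (rule bounded_linear_intro[where K=1]) (auto simp: star_add star_scaleR)
  then have "(\<lambda>n. star (p n)) \<longlonglongrightarrow> star q" using lim by (rule bounded_linear.tendsto)
  moreover have "(\<lambda>n. star (p n)) = p" using p by (auto simp: nonneg_star)
  ultimately have "star q = q" using lim LIMSEQ_unique by metis
  moreover obtain K where K: "\<And>n. norm (p n) \<le> K"
    using Bseq_def convergent_imp_Bseq[of p] lim convergentI by metis
  have "norm (K *\<^sub>R b - q * b) \<le> K * norm b" for b
  proof (rule LIMSEQ_le_const2)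
    show "(\<lambda>n. norm (K *\<^sub>R b - p n * b)) \<longlonglongrightarrow> norm (K *\<^sub>R b - q * b)"
      by (intro tendsto_intros lim)
    show "\<exists>N. \<forall>n\<ge>N. norm (K *\<^sub>R b - p n * b) \<le> K * norm b"
      using nonneg_norm_le[OF p K] by blast
  qed
  ultimately show ?thesis by (auto simp: nonneg_def)
qed

text \<open>
  An inverse of \<open>a + l\<close> in the unitization bounds multiplication by \<open>a + l\<close> from below.
\<close>

lemma positive_imp_nonneg:
  assumes "positive a" shows "nonneg a"
proof -
  have star: "star a = a" using assms by (simp add: positive_def)
  moreover have "norm (norm a *\<^sub>R b - a * b) \<le> norm a * norm b" for b
  proof (rule norm_diff_le_of_bounded_below[OF star order_refl])
    fix l :: real assume l: "l > 0"
    have "complex_of_real (- l) \<notin> complex_of_real ` {0..}"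
      using l by (auto simp del: of_real_minus)
    then have "complex_of_real (- l) \<notin> spectrum a" using assms by (auto simp: positive_def)
    then obtain v where "unitization_mult v (a, complex_of_real l) = (0, 1)"
      by (auto simp: spectrum_def)
    then have v: "fst v * a + snd v *\<^sub>C a + l *\<^sub>R fst v = 0" "snd v * complex_of_real l = 1"
      by (auto simp: unitization_mult_def scaleC_of_real)
    define M where "M = norm (fst v) + cmod (snd v)"
    have b: "norm b \<le> M * norm (a * b + l *\<^sub>R b)" for b
    proof -
      have "fst v * (a * b + l *\<^sub>R b) + snd v *\<^sub>C (a * b + l *\<^sub>R b)
          = (fst v * a + snd v *\<^sub>C a + l *\<^sub>R fst v) * b + (snd v * complex_of_real l) *\<^sub>C b"
        by (simp add: distrib_left distrib_right mult.assoc mult_scaleC_left scaleC_add_right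
            scaleC_of_real flip: scaleC_scaleC)
      then have "b = fst v * (a * b + l *\<^sub>R b) + snd v *\<^sub>C (a * b + l *\<^sub>R b)"
        by (simp only: v) simp
      then have "norm b \<le> norm (fst v * (a * b + l *\<^sub>R b)) + norm (snd v *\<^sub>C (a * b + l *\<^sub>R b))"
        by (metis norm_triangle_ineq)
      also have "\<dots> \<le> M * norm (a * b + l *\<^sub>R b)"
        by (simp add: M_def norm_scaleC distrib_right norm_mult_ineq)
      finally show ?thesis .
    qed
    have "1 / (M + 1) * norm b \<le> norm (a * b + l *\<^sub>R b)" for b
    proof -
      have "M \<ge> 0" by (simp add: M_def)
      moreover have "norm b \<le> (M + 1) * norm (a * b + l *\<^sub>R b)"
        using b[of b] by (simp add: distrib_right add_increasing2)
      ultimately show ?thesis by (simp add: field_simps)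
    qed
    moreover have "1 / (M + 1) > 0" by (simp add: M_def add_nonneg_pos)
    ultimately show "\<exists>\<delta>>0. \<forall>b. \<delta> * norm b \<le> norm (a * b + l *\<^sub>R b)" by blast
  qed
  ultimately show ?thesis by (auto simp: nonneg_def)
qed

text \<open>
  From \<open>- c \<le> w \<le> c\<close> one gets \<open>\<plusminus> w \<le> \<rho>\<close>, where \<open>\<rho>\<close> is the norm of \<open>c\<close>. The two lemmas that follow,
  on which all later norm comparisons rest, are the cases \<open>w = p - q\<close> and \<open>w = p\<close>, both with \<open>c = p + q\<close>.
\<close>

lemma norm_le_of_nonneg_both:
  assumes w: "star w = w" and "nonneg (c + w)" "nonneg (c - w)"
  shows "norm w \<le> norm (c::'a::cstar_algebra)"
proof -
  interpret A: cs_module "\<lambda>a b :: 'a. star a * b" by (rule cs_module_algebra)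
  from assms obtain s t where st: "\<And>b. norm (s *\<^sub>R b - (c + w) * b) \<le> s * norm b"
    "\<And>b. norm (t *\<^sub>R b - (c - w) * b) \<le> t * norm b" by (auto simp: nonneg_def)
  have cb: "norm (c * b) \<le> norm c * norm b" for b by (rule norm_mult_ineq)
  have "norm (w * b) \<le> norm c * norm b" for b
  proof (rule A.norm_le_of_shifts[OF selfadj_mult[OF w]])
    show "norm (t *\<^sub>R b + w * b) \<le> (t + norm c) * norm b" for b
      using norm_triangle_ineq[of "t *\<^sub>R b - (c - w) * b" "c * b"] st(2)[of b] cb[of b]
      by (simp add: algebra_simps)
    show "norm (s *\<^sub>R b - w * b) \<le> (s + norm c) * norm b" for b
      using norm_triangle_ineq[of "s *\<^sub>R b - (c + w) * b" "c * b"] st(1)[of b] cb[of b]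
      by (simp add: algebra_simps)
  qed simp
  from this[of w] have "norm w * norm w \<le> norm c * norm w"
    using cstar_identity[of w] by (simp add: w power2_eq_square)
  then show ?thesis by (cases "w = 0") auto
qed

lemma norm_diff_le_norm_add:
  assumes "nonneg p" "nonneg q" shows "norm (p - q) \<le> norm (p + q)"
proof (rule norm_le_of_nonneg_both)
  have "p + q + (p - q) = 2 *\<^sub>R p" "p + q - (p - q) = 2 *\<^sub>R q" by (simp_all add: scaleR_2)
  with assms show "nonneg (p + q + (p - q))" "nonneg (p + q - (p - q))"
    by (simp_all only: nonneg_scaleR)
qed (simp add: assms star_diff nonneg_star)

lemma norm_le_norm_add:
  assumes "nonneg p" "nonneg q" shows "norm p \<le> norm (p + q)"
proof (rule norm_le_of_nonneg_both)
  show "nonneg (p + q + p)" "nonneg (p + q - p)" using assms by (simp_all add: nonneg_add)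
qed (simp add: assms nonneg_star)

section \<open>The Cauchy--Schwarz inequality and positive forms on Hilbert modules\<close>

lemma hilbert_module_ip_module:
  assumes "hilbert_module act ip" shows "ip_module ip"
proof -
  interpret hilbert_module act ip by fact
  show ?thesis by unfold_locales (auto simp: ip_add_right ip_scaleC_right ip_star norm_eq)
qed

lemma hilbert_module_nonneg:
  assumes "hilbert_module act ip" shows "nonneg (ip x x)"
  using assms hilbert_module.ip_positive positive_imp_nonneg by blast

text \<open>
  The Cauchy--Schwarz inequality by polarization. Put \<open>a = \<langle>y, x\<rangle>\<close> and \<open>z = t y a\<close>. The elements
  \<open>\<langle>x + z, x + z\<rangle>\<close> and \<open>\<langle>x - z, x - z\<rangle>\<close> are nonnegative, their difference is \<open>4t a\<^sup>* a\<close>, and their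
  sum is \<open>2\<langle>x, x\<rangle> + 2\<langle>z, z\<rangle>\<close>. The difference is no larger in norm than the sum.
\<close>

lemma hilbert_module_cs_module:
  fixes act :: "'h::complex_banach \<Rightarrow> 'a::cstar_algebra \<Rightarrow> 'h"
  assumes hm: "hilbert_module act ip" shows "cs_module ip"
proof -
  interpret M: hilbert_module act ip by fact
  interpret ip_module ip using hm by (rule hilbert_module_ip_module)
  have "norm (ip y x) \<le> norm x * norm y" for x y
  proof (cases "ip y x = 0")
    case False
    define a where "a = ip y x"
    have pos: "norm a > 0" "norm x > 0" "norm y > 0" using False by (auto simp: a_def)
    \<comment> \<open>This \<open>t\<close> is the optimal one: it brings the bound on the norm of \<open>z\<close> up to the norm of \<open>x\<close>.\<close>
    define t where "t = norm x / (norm a * norm y)"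
    define z where "z = t *\<^sub>R act y a"
    have xy: "ip x y = star a" by (simp add: a_def ip_star)
    have xz: "ip x z = t *\<^sub>R (star a * a)" by (simp add: z_def ip_scaleR_right M.ip_act_right xy)
    then have zx: "ip z x = t *\<^sub>R (star a * a)"
      by (metis ip_star star_mult star_scaleR star_star)
    have "norm (act y a) \<le> norm a * norm y"
    proof (rule power2_le_imp_le)
      have "ip (act y a) y = star a * ip y y"
        by (metis M.ip_act_right ip_star star_mult)
      then have "(norm (act y a))\<^sup>2 = norm (star a * ip y y * a)"
        by (simp add: M.ip_act_right flip: norm_ip_self)
      also have "\<dots> \<le> norm (star a) * norm (ip y y) * norm a"
        by (meson norm_mult_ineq mult_right_mono norm_ge_zero order_trans)
      finally show "(norm (act y a))\<^sup>2 \<le> (norm a * norm y)\<^sup>2"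
        by (simp add: norm_ip_self power2_eq_square mult_ac)
    qed simp
    then have "norm z \<le> t * (norm a * norm y)" using pos by (simp add: z_def t_def mult_left_mono divide_right_mono del: times_divide_eq_left)
    then have z: "norm z \<le> norm x" using pos by (simp add: t_def)
    have "norm (ip (x + z) (x + z) - ip (x - z) (x - z)) \<le> norm (ip (x + z) (x + z) + ip (x - z) (x - z))"
      by (intro norm_diff_le_norm_add hilbert_module_nonneg[OF hm])
    also have "ip (x + z) (x + z) + ip (x - z) (x - z) = 2 *\<^sub>R ip x x + 2 *\<^sub>R ip z z"
      by (simp add: ip_simps scaleR_2)
    also have "norm \<dots> \<le> 2 * (norm x)\<^sup>2 + 2 * (norm z)\<^sup>2"
      by (rule order_trans[OF norm_triangle_ineq]) (simp add: norm_ip_self)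
    also have "\<dots> \<le> 4 * (norm x)\<^sup>2" using power_mono[OF z, of 2] by simp
    also have "ip (x + z) (x + z) - ip (x - z) (x - z) = (4 * t) *\<^sub>R (star a * a)"
    proof -
      have "ip (x + z) (x + z) - ip (x - z) (x - z) = 2 *\<^sub>R ip x z + 2 *\<^sub>R ip z x"
        by (simp add: ip_simps scaleR_2)
      then show ?thesis by (simp add: xz zx flip: scaleR_left.add)
    qed
    finally have "t * (norm a)\<^sup>2 \<le> (norm x)\<^sup>2"
      using pos by (simp add: cstar_identity t_def)
    then show ?thesis using pos
      by (simp add: t_def power2_eq_square field_simps a_def)
  qed simp
  then have "norm (ip x y) \<le> norm x * norm y" for x y by (metis mult.commute)
  then show ?thesis by unfold_locales
qed

locale hilbert_cs_module = hilbert_module act ip + cs: cs_module ip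
  for act :: "'k::complex_banach \<Rightarrow> 'a::cstar_algebra \<Rightarrow> 'k" and ip
begin

lemma nonneg_ip_self: "nonneg (ip x x)"
  using ip_positive by (rule positive_imp_nonneg)

text \<open>
  Write \<open>g u = \<langle>u, (1 - Z\<^sup>2) u\<rangle>\<close>. The identity \<open>1 - z\<^sup>2 = (1 - z\<^sup>2)\<^sup>2 + z\<^sup>2(1 - z\<^sup>2)\<close> says that \<open>g u\<close> exceeds
  \<open>g (Z u)\<close> by an element of the form \<open>\<langle>y, y\<rangle>\<close>. Iterating exhibits \<open>g x\<close> as an infinite sum of such
  elements, in place of the square root of \<open>1 - Z\<^sup>2\<close>.
\<close>

lemma nonneg_ip_diff_square:
  assumes Z: "cs.selfadj Z" and "0 \<le> \<theta>" "\<theta> < 1" and le: "\<And>x. norm (Z x) \<le> \<theta> * norm x"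
  shows "nonneg (ip x x - ip (Z x) (Z x))"
proof -
  note [simp] = cs.selfadj_linear[OF Z]
  have sa: "ip (Z u) v = ip u (Z v)" for u v using Z by (simp add: is_adjoint_def)
  define g where "g u = ip u u - ip (Z u) (Z u)" for u
  have g: "g u = ip (u - Z (Z u)) (u - Z (Z u)) + g (Z u)" for u
    by (simp add: g_def cs.ip_simps sa)
  have partial: "nonneg (g x - g ((Z ^^ n) x))" for n
  proof (induction n)
    case 0
    show ?case using nonneg_ip_self[of 0] by simp
  next
    case (Suc n)
    have "g x - g ((Z ^^ Suc n) x) = (g x - g ((Z ^^ n) x)) + (g ((Z ^^ n) x) - g (Z ((Z ^^ n) x)))"
      by simp
    also have "g ((Z ^^ n) x) - g (Z ((Z ^^ n) x)) =
        ip ((Z ^^ n) x - Z (Z ((Z ^^ n) x))) ((Z ^^ n) x - Z (Z ((Z ^^ n) x)))"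
      using g[of "(Z ^^ n) x"] by simp
    finally show ?case using Suc nonneg_ip_self by (metis nonneg_add)
  qed
  have pow: "norm ((Z ^^ n) x) \<le> \<theta> ^ n * norm x" for n
  proof (induction n)
    case (Suc n)
    have "norm ((Z ^^ Suc n) x) \<le> \<theta> * norm ((Z ^^ n) x)" using le by simp
    also have "\<dots> \<le> \<theta> * (\<theta> ^ n * norm x)" using Suc assms(2) by (rule mult_left_mono)
    finally show ?case by (simp add: mult.assoc)
  qed simp
  have "norm (g ((Z ^^ n) x)) \<le> 2 * (\<theta> ^ n * norm x)\<^sup>2" for n
  proof -
    let ?u = "(Z ^^ n) x"
    have "norm (Z ?u) \<le> norm ?u"
      using le[of ?u] assms(3) mult_right_mono[of \<theta> 1 "norm ?u"] by simp
    then have "(norm (Z ?u))\<^sup>2 \<le> (norm ?u)\<^sup>2" by (intro power_mono) auto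
    then have "norm (g ?u) \<le> 2 * (norm ?u)\<^sup>2"
      unfolding g_def using norm_triangle_ineq4[of "ip ?u ?u" "ip (Z ?u) (Z ?u)"]
      unfolding cs.norm_ip_self by linarith
    also have "\<dots> \<le> 2 * (\<theta> ^ n * norm x)\<^sup>2" using power_mono[OF pow, of n 2] by simp
    finally show ?thesis .
  qed
  moreover have "(\<lambda>n. 2 * (\<theta> ^ n * norm x)\<^sup>2) \<longlonglongrightarrow> 2 * (0 * norm x)\<^sup>2"
    by (intro tendsto_intros LIMSEQ_realpow_zero assms)
  then have "(\<lambda>n. 2 * (\<theta> ^ n * norm x)\<^sup>2) \<longlonglongrightarrow> 0"
    by (simp only: mult_zero_left power_zero_numeral mult_zero_right)
  ultimately have "(\<lambda>n. g ((Z ^^ n) x)) \<longlonglongrightarrow> 0"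
    by (rule Lim_null_comparison[OF always_eventually[OF allI]])
  then have "(\<lambda>n. g x - g ((Z ^^ n) x)) \<longlonglongrightarrow> g x - 0" by (intro tendsto_intros)
  with partial have "nonneg (g x - 0)" by (rule nonneg_tendsto)
  then show ?thesis by (simp add: g_def)
qed

text \<open>
  The identity \<open>2(1 - v) = (1 - v)\<^sup>2 + (1 - v\<^sup>2)\<close> reduces the claim to the preceding lemma for the
  strict contractions \<open>V = \<theta> Z\<close>; then \<open>\<theta>\<close> tends to 1.
\<close>

lemma nonneg_ip_diff_contraction:
  assumes Z: "cs.selfadj Z" and le: "\<And>x. norm (Z x) \<le> norm x"
  shows "nonneg (ip x x - ip x (Z x))"
proof -
  have *: "nonneg (ip x x - \<theta> *\<^sub>R ip x (Z x))" if \<theta>: "0 \<le> \<theta>" "\<theta> < 1" for \<theta>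
  proof -
    define V where "V u = \<theta> *\<^sub>R Z u" for u
    have V: "cs.selfadj V" using Z by (simp add: is_adjoint_def V_def cs.ip_simps)
    have "norm (V u) \<le> \<theta> * norm u" for u
      using le[of u] \<theta> by (simp add: V_def mult_left_mono)
    then have "nonneg (ip x x - ip (V x) (V x))"
      using nonneg_ip_diff_square[OF V \<theta>] by blast
    then have "nonneg ((1/2) *\<^sub>R (ip (x - V x) (x - V x) + (ip x x - ip (V x) (V x))))"
      by (intro nonneg_scaleR nonneg_add nonneg_ip_self) auto
    moreover have "ip (V x) x = ip x (V x)" using V by (simp add: is_adjoint_def)
    then have "ip (x - V x) (x - V x) + (ip x x - ip (V x) (V x)) = 2 *\<^sub>R (ip x x - ip x (V x))"
      by (simp add: cs.ip_simps scaleR_2)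
    ultimately show ?thesis by (simp add: V_def cs.ip_scaleR_right)
  qed
  have "(\<lambda>n. ip x x - (real n / real (Suc n)) *\<^sub>R ip x (Z x)) \<longlonglongrightarrow> ip x x - 1 *\<^sub>R ip x (Z x)"
    by (intro tendsto_intros LIMSEQ_n_over_Suc_n)
  then have "nonneg (ip x x - 1 *\<^sub>R ip x (Z x))"
    by (rule nonneg_tendsto[rotated]) (intro *; simp)
  then show ?thesis by simp
qed

text \<open>
  Invertibility of \<open>D + l\<close> for \<open>l > 0\<close> bounds the norm of \<open>t - D\<close> by \<open>t\<close>, so \<open>Z = 1 - D / t\<close> is a
  contraction and \<open>D = t(1 - Z)\<close>.
\<close>

lemma nonneg_ip_of_op_positive:
  assumes "op_positive ip D" shows "nonneg (ip x (D x))"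
proof -
  from assms obtain R where "is_adjoint ip ip D R" by (auto simp: op_positive_def adjointables_def)
  then have "adj ip ip D = R" by (rule adj_eqI[OF cs.ip_module_axioms])
  with assms \<open>is_adjoint ip ip D R\<close> have D: "cs.selfadj D" by (simp add: op_positive_def)
  interpret D: bounded_linear D by (rule cs.selfadj_bounded_linear) fact
  define t where "t = onorm D + 1"
  have t: "t > 0" "onorm D \<le> t" using onorm_pos_le[OF D.bounded_linear_axioms] by (simp_all add: t_def)
  have refl: "norm (t *\<^sub>R x - D x) \<le> t * norm x" for x
  proof (rule cs.norm_reflection_le[OF D t(2)])
    fix l :: real assume l: "l > 0"
    have "complex_of_real (- l) \<notin> complex_of_real ` {0..}"
      using l by (auto simp del: of_real_minus)
    then have "complex_of_real (- l) \<notin> op_spectrum ip D" using assms by (auto simp: op_positive_def)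
    then obtain B where B: "B \<in> adjointables ip ip" "B \<circ> (\<lambda>x. D x - complex_of_real (- l) *\<^sub>C x) = id"
      by (auto simp: op_spectrum_def)
    then have B_eq: "B (D x + l *\<^sub>R x) = x" for x
      by (metis (no_types, lifting) comp_apply diff_minus_eq_add id_apply scaleC_of_real scaleR_minus_left)
    have lin: "bounded_linear B"
      using B(1) is_adjoint_bounded_linear[OF cs.cs_module_axioms cs.cs_module_axioms]
      by (auto simp: adjointables_def)
    have nn: "onorm B \<ge> 0" by (rule onorm_pos_le) fact
    have "1 / (onorm B + 1) * norm x \<le> norm (D x + l *\<^sub>R x)" for x
    proof -
      have "norm x \<le> onorm B * norm (D x + l *\<^sub>R x)"
        using onorm[OF lin, of "D x + l *\<^sub>R x"] by (simp add: B_eq)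
      then have "norm x \<le> (onorm B + 1) * norm (D x + l *\<^sub>R x)"
        by (simp add: distrib_right add_increasing2)
      then show ?thesis using nn by (simp add: field_simps)
    qed
    moreover have "1 / (onorm B + 1) > 0" using nn by simp
    ultimately show "\<exists>\<delta>>0. \<forall>x. \<delta> * norm x \<le> norm (D x + l *\<^sub>R x)" by blast
  qed
  define Z where "Z x = x - (1 / t) *\<^sub>R D x" for x
  have "cs.selfadj Z" using D by (simp add: is_adjoint_def Z_def cs.ip_simps)
  moreover have "norm (Z x) \<le> norm x" for x
  proof -
    have "t *\<^sub>R Z x = t *\<^sub>R x - D x" using t by (simp add: Z_def scaleR_diff_right)
    then have "t * norm (Z x) \<le> t * norm x" using refl[of x] t by (metis abs_of_pos norm_scaleR)
    then show ?thesis using t by simp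
  qed
  ultimately have "nonneg (t *\<^sub>R (ip x x - ip x (Z x)))"
    using t by (intro nonneg_scaleR nonneg_ip_diff_contraction) auto
  then show ?thesis using t by (simp add: Z_def cs.ip_simps)
qed

end

section \<open>Bounded below implies positive\<close>

context cs_module
begin

text \<open>
  The Neumann series in the form of a fixed point: \<open>D x - d x = y\<close> says that \<open>x\<close> is a fixed point of
  \<open>x \<mapsto> (D - c)\<^sup>-\<^sup>1(y + (d - c) x)\<close>.
\<close>

lemma surj_shift_near:
  assumes D: "selfadj D" and surj: "surj (\<lambda>x. D x - c *\<^sub>C x)"
    and below: "\<And>x. \<delta> * norm x \<le> norm (D x - c *\<^sub>C x)" and near: "cmod (d - c) < \<delta>"
  shows "surj (\<lambda>x. D x - d *\<^sub>C x)"
  unfolding surj_def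
proof
  fix y
  define f where "f = (\<lambda>x. D x - c *\<^sub>C x)"
  define F where "F x = inv f (y + (d - c) *\<^sub>C x)" for x
  have \<delta>: "\<delta> > 0" using near norm_ge_zero[of "d - c"] by linarith
  have f_inv: "f (inv f u) = u" for u using surj unfolding f_def[symmetric] by (rule surj_f_inv_f)
  have "\<exists>!x. F x = x"
  proof (rule banach_fix_type)
    show "0 \<le> cmod (d - c) / \<delta>" "cmod (d - c) / \<delta> < 1" using near \<delta> by simp_all
    have "dist (F x) (F x') \<le> cmod (d - c) / \<delta> * dist x x'" for x x'
    proof -
      have "f (F x - F x') = f (F x) - f (F x')"
        by (simp add: f_def selfadj_linear[OF D] scaleC_diff_right)
      also have "\<dots> = (d - c) *\<^sub>C (x - x')" by (simp add: F_def f_inv scaleC_diff_right)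
      finally have "\<delta> * norm (F x - F x') \<le> cmod (d - c) * norm (x - x')"
        using below[of "F x - F x'"] by (simp add: f_def norm_scaleC)
      then show ?thesis using \<delta> by (simp add: dist_norm field_simps)
    qed
    then show "\<forall>x x'. dist (F x) (F x') \<le> cmod (d - c) / \<delta> * dist x x'" by blast
  qed
  then obtain x where "F x = x" by blast
  then have "f x = y + (d - c) *\<^sub>C x" by (metis F_def f_inv)
  then have "y = D x - d *\<^sub>C x" by (simp add: f_def scaleC_diff_left algebra_simps)
  then show "\<exists>x. y = D x - d *\<^sub>C x" ..
qed

lemma surj_shift_large:
  assumes D: "selfadj D" and c: "onorm D < cmod c"
  shows "surj (\<lambda>x. D x - c *\<^sub>C x)"
  unfolding surj_def
proof
  fix y
  interpret D: bounded_linear D by (rule selfadj_bounded_linear) fact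
  have c0: "c \<noteq> 0" "onorm D \<ge> 0" using c onorm_pos_le[OF D.bounded_linear_axioms] by auto
  define F where "F x = inverse c *\<^sub>C (D x - y)" for x
  have "\<exists>!x. F x = x"
  proof (rule banach_fix_type)
    show "0 \<le> onorm D / cmod c" "onorm D / cmod c < 1" using c c0 by (simp_all add: field_simps)
    have "dist (F x) (F x') \<le> onorm D / cmod c * dist x x'" for x x'
    proof -
      have "F x - F x' = inverse c *\<^sub>C D (x - x')"
        by (simp add: F_def D.diff flip: scaleC_diff_right)
      then have "dist (F x) (F x') = norm (D (x - x')) / cmod c"
        by (simp add: dist_norm norm_scaleC norm_inverse divide_inverse_commute)
      then show ?thesis
        using divide_right_mono[OF onorm[OF D.bounded_linear_axioms, of "x - x'"], of "cmod c"]
        by (simp add: dist_norm)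
    qed
    then show "\<forall>x x'. dist (F x) (F x') \<le> onorm D / cmod c * dist x x'" by blast
  qed
  then obtain x where "F x = x" by blast
  then have "c *\<^sub>C x = D x - y" using c0 by (metis F_def right_inverse scaleC_one scaleC_scaleC)
  then have "y = D x - c *\<^sub>C x" by simp
  then show "\<exists>x. y = D x - c *\<^sub>C x" ..
qed

text \<open>
  As \<open>\<langle>x, D x\<rangle>\<close> is self-adjoint, the anti-self-adjoint part of \<open>\<langle>x, (D - c) x\<rangle>\<close> comes from \<open>c\<close> alone.
\<close>

lemma norm_shift_ge_Im:
  assumes D: "selfadj D" shows "\<bar>Im c\<bar> * norm x \<le> norm (D x - c *\<^sub>C x)"
proof (cases "x = 0")
  case False
  define a where "a = ip x (D x - c *\<^sub>C x)"
  have "star (ip x (D x)) = ip x (D x)" using D by (metis ip_star is_adjoint_def)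
  then have "a - star a = (cnj c - c) *\<^sub>C ip x x"
    by (simp add: a_def ip_simps star_diff star_scaleC ip_star scaleC_diff_left)
  moreover have "cmod (cnj c - c) = 2 * \<bar>Im c\<bar>"
    by (simp add: cmod_def real_sqrt_mult)
  ultimately have "2 * \<bar>Im c\<bar> * (norm x)\<^sup>2 = norm (a - star a)"
    by (simp add: norm_scaleC norm_ip_self)
  also have "\<dots> \<le> 2 * norm a" using norm_triangle_ineq4[of a "star a"] by simp
  also have "\<dots> \<le> 2 * (norm x * norm (D x - c *\<^sub>C x))" using norm_ip_le by (simp add: a_def)
  finally have "norm x * (\<bar>Im c\<bar> * norm x) \<le> norm x * norm (D x - c *\<^sub>C x)"
    by (simp add: power2_eq_square mult_ac)
  with False show ?thesis by simp
qed simp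

text \<open>
  Closed submodules need not be complemented, so the argument familiar from Hilbert spaces does not
  show that an operator bounded below together with its adjoint is surjective. Instead,
  surjectivity is carried along a ray: for \<open>c\<close> outside the nonnegative half-line there is a ray from \<open>c\<close> to infinity on which
  \<open>D - d\<close> is bounded below by one constant \<open>\<delta>\<close>; it is surjective for large \<open>d\<close>, and surjectivity
  propagates towards \<open>c\<close> in steps shorter than \<open>\<delta>\<close>.
\<close>

lemma op_positive_of_bounded_below:
  assumes D: "selfadj D"
    and below: "\<And>l. l > 0 \<Longrightarrow> \<exists>\<delta>>0. \<forall>x. \<delta> * norm x \<le> norm (D x + l *\<^sub>R x)"
  shows "op_positive ip D"
proof -
  interpret D: bounded_linear D by (rule selfadj_bounded_linear) fact
  \<comment> \<open>Non-real \<open>c\<close> are moved vertically away from the real axis, negative \<open>c\<close> to the left.\<close>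
  have ray: "\<exists>\<delta>>0. \<exists>w. cmod w = 1 \<and> (\<forall>s\<ge>0. \<forall>x. \<delta> * norm x \<le> norm (D x - (c + of_real s * w) *\<^sub>C x))"
    if c: "c \<notin> complex_of_real ` {0..}" for c
  proof (cases "Im c = 0")
    case False
    define w where "w = of_real (sgn (Im c)) * \<i>"
    have "\<bar>Im c\<bar> * norm x \<le> norm (D x - (c + of_real s * w) *\<^sub>C x)" if "s \<ge> 0" for s x
    proof -
      have "\<bar>Im c\<bar> \<le> \<bar>Im (c + of_real s * w)\<bar>" using that by (auto simp: w_def sgn_if)
      then show ?thesis
        using norm_shift_ge_Im[OF D] by (meson mult_right_mono norm_ge_zero order_trans)
    qed
    then show ?thesis using False
      by (intro exI[of _ "\<bar>Im c\<bar>"] conjI exI[of _ w]) (auto simp: w_def norm_mult sgn_if)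
  next
    case True
    then have "c = of_real (Re c)" by (simp add: complex_eq_iff)
    with c have neg: "Re c < 0" by (metis atLeast_iff image_eqI linorder_not_less)
    have "- Re c * norm x \<le> norm (D x - (c + of_real s * (- 1)) *\<^sub>C x)" if "s \<ge> 0" for s x
    proof -
      let ?t = "onorm D" and ?l = "s - Re c"
      have "norm (?t *\<^sub>R x - D x) \<le> ?t * norm x"
        by (rule norm_reflection_le[OF D order_refl below])
      moreover have "norm ((?t + ?l) *\<^sub>R x) = (?t + ?l) * norm x"
        using that neg onorm_pos_le[OF D.bounded_linear_axioms] by simp
      ultimately have "?l * norm x \<le> norm (D x + ?l *\<^sub>R x)"
        using norm_triangle_ineq2[of "(?t + ?l) *\<^sub>R x" "?t *\<^sub>R x - D x"] by (simp add: algebra_simps)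
      moreover have "D x - (c + of_real s * (- 1)) *\<^sub>C x = D x + ?l *\<^sub>R x"
      proof -
        have "c + of_real s * (- 1) = of_real (- ?l)"
          by (subst \<open>c = of_real (Re c)\<close>) simp
        then show ?thesis by (simp only: scaleC_of_real scaleR_minus_left diff_minus_eq_add)
      qed
      moreover have "- Re c * norm x \<le> ?l * norm x" using that by (intro mult_right_mono) auto
      ultimately show ?thesis by (simp only:)
    qed
    then show ?thesis using neg by (intro exI[of _ "- Re c"] conjI exI[of _ "- 1"]) auto
  qed
  have bij: "bij (\<lambda>x. D x - c *\<^sub>C x)" if c: "c \<notin> complex_of_real ` {0..}" for c
  proof -
    from ray[OF c] obtain \<delta> w where \<delta>: "\<delta> > 0" and w: "cmod w = 1"
      and le: "\<And>s x. s \<ge> 0 \<Longrightarrow> \<delta> * norm x \<le> norm (D x - (c + of_real s * w) *\<^sub>C x)" by blast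
    \<comment> \<open>The points \<open>p n\<close> divide the ray into steps of length \<open>\<delta> / 2\<close>.\<close>
    define p where "p n = c + of_real (real n * (\<delta> / 2)) * w" for n :: nat
    have p: "\<delta> * norm x \<le> norm (D x - p n *\<^sub>C x)" for n x
      unfolding p_def by (rule le) (use \<delta> in simp)
    have "\<delta> / 2 > 0" using \<delta> by simp
    then obtain n where n: "onorm D + cmod c < real n * (\<delta> / 2)"
      using reals_Archimedean3 by blast
    have "surj (\<lambda>x. D x - p n *\<^sub>C x)"
    proof (rule surj_shift_large[OF D])
      have "real n * (\<delta> / 2) = cmod (p n - c)" using \<delta> w by (simp add: p_def norm_mult)
      also have "\<dots> \<le> cmod (p n) + cmod c" by (rule norm_triangle_ineq4)
      finally show "onorm D < cmod (p n)" using n by simp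
    qed
    then have "surj (\<lambda>x. D x - p 0 *\<^sub>C x)"
    proof (induction n)
      case (Suc n)
      have "p n - p (Suc n) = - (of_real (\<delta> / 2) * w)" by (simp add: p_def algebra_simps)
      then have "cmod (p n - p (Suc n)) < \<delta>" using \<delta> w by (simp add: norm_mult)
      then show ?case using Suc surj_shift_near[OF D _ p] by blast
    qed
    then have "surj (\<lambda>x. D x - c *\<^sub>C x)" by (simp add: p_def)
    moreover have "inj (\<lambda>x. D x - c *\<^sub>C x)"
    proof (rule injI)
      fix x y assume "D x - c *\<^sub>C x = D y - c *\<^sub>C y"
      then have "D (x - y) - c *\<^sub>C (x - y) = 0" by (simp add: D.diff scaleC_diff_right algebra_simps)
      then show "x = y" using p[of "x - y" 0] \<delta> by (simp add: p_def mult_le_0_iff)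
    qed
    ultimately show ?thesis by (rule bijI[rotated])
  qed
  have "c \<notin> op_spectrum ip D" if c: "c \<notin> complex_of_real ` {0..}" for c
  proof -
    have c': "cnj c \<notin> complex_of_real ` {0..}" using c by (metis complex_cnj_cnj complex_cnj_complex_of_real image_iff)
    define f where "f d = (\<lambda>x. D x - d *\<^sub>C x)" for d
    have b: "bij (f c)" "bij (f (cnj c))" using bij c c' by (simp_all add: f_def)
    have adj: "ip (f c u) v = ip u (f (cnj c) v)" for u v
      using D by (simp add: f_def ip_simps is_adjoint_def)
    have "is_adjoint ip ip (inv (f c)) (inv (f (cnj c)))"
      unfolding is_adjoint_def
      by (metis adj b bij_is_surj surj_f_inv_f)
    then have "inv (f c) \<in> adjointables ip ip" by (auto simp: adjointables_def)
    moreover have "inv (f c) \<circ> f c = id" "f c \<circ> inv (f c) = id"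
      using b(1) by (simp_all add: bij_is_inj bij_is_surj surj_iff[symmetric])
    ultimately show ?thesis unfolding op_spectrum_def f_def by blast
  qed
  moreover have "D \<in> adjointables ip ip" using D by (auto simp: adjointables_def)
  moreover have "adj ip ip D = D" using adj_eqI[OF ip_module_axioms D] .
  ultimately show ?thesis unfolding op_positive_def by blast
qed

end

section \<open>Norm comparison and operator order\<close>

text \<open>
  Put \<open>D = S S\<^sup>* - T T\<^sup>*\<close>, so that \<open>\<langle>x, D x\<rangle> = \<langle>S\<^sup>* x, S\<^sup>* x\<rangle> - \<langle>T\<^sup>* x, T\<^sup>* x\<rangle>\<close>. If \<open>D\<close> is positive, this is a
  nonnegative element, and adding it to \<open>\<langle>T\<^sup>* x, T\<^sup>* x\<rangle>\<close> cannot lower the norm. For the converse it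
  remains to bound \<open>D + l\<close> from below using norms only. Let \<open>q = \<langle>S\<^sup>* x, S\<^sup>* x\<rangle>\<close>, \<open>p = \<langle>T\<^sup>* x, T\<^sup>* x\<rangle>\<close>, \<open>r = \<langle>x, x\<rangle>\<close>
  and suppose \<open>\<langle>x, (D + l) x\<rangle> = q + l r - p\<close> has norm at most \<open>e\<close>. As \<open>p\<close> is no larger in norm than
  \<open>q\<close>, the norm of \<open>q + l r\<close> exceeds that of \<open>q\<close> by at most \<open>e\<close>. But \<open>q \<le> m r\<close> for some \<open>m\<close>, so
  \<open>q + l r\<close> dominates \<open>(1 + l / m) q\<close>. This forces \<open>q\<close>, then \<open>q + l r\<close>, and finally \<open>r\<close> to have norm
  at most a multiple of \<open>e\<close>.
\<close>

theorem theorem2p4: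
  fixes actE :: "'e::complex_banach \<Rightarrow> 'a::cstar_algebra \<Rightarrow> 'e" and ipE :: "'e \<Rightarrow> 'e \<Rightarrow> 'a"
    and actH :: "'h::complex_banach \<Rightarrow> 'a \<Rightarrow> 'h" and ipH :: "'h \<Rightarrow> 'h \<Rightarrow> 'a"
    and actK :: "'k::complex_banach \<Rightarrow> 'a \<Rightarrow> 'k" and ipK :: "'k \<Rightarrow> 'k \<Rightarrow> 'a"
    and T :: "'e \<Rightarrow> 'k" and S :: "'h \<Rightarrow> 'k"
  assumes "hilbert_module actE ipE"
    and "hilbert_module actH ipH"
    and "hilbert_module actK ipK"
    and "T \<in> adjointables ipE ipK"
    and "S \<in> adjointables ipH ipK"
  shows "op_le ipK (T \<circ> adj ipE ipK T) (S \<circ> adj ipH ipK S)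
     \<longleftrightarrow> (\<forall>x. norm (adj ipE ipK T x) \<le> norm (adj ipH ipK S x))"
proof -
  interpret E: cs_module ipE using assms(1) by (rule hilbert_module_cs_module)
  interpret H: cs_module ipH using assms(2) by (rule hilbert_module_cs_module)
  interpret K: hilbert_cs_module actK ipK
    using assms(3) by (intro hilbert_cs_module.intro hilbert_module_cs_module)
  obtain T' S' where T': "is_adjoint ipE ipK T T'" and S': "is_adjoint ipH ipK S S'"
    using assms(4,5) by (auto simp: adjointables_def)
  have adj: "adj ipE ipK T = T'" "adj ipH ipK S = S'"
    using adj_eqI E.ip_module_axioms H.ip_module_axioms T' S' by blast+
  have T: "ipK x (T z) = ipE (T' x) z" for x z
    using is_adjoint_sym[OF E.ip_module_axioms K.cs.ip_module_axioms T'] by (simp add: is_adjoint_def)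
  have S: "ipK x (S z) = ipH (S' x) z" for x z
    using is_adjoint_sym[OF H.ip_module_axioms K.cs.ip_module_axioms S'] by (simp add: is_adjoint_def)
  define B where "B x = S (S' x)" for x
  define D where "D x = S (S' x) - T (T' x)" for x
  have B: "K.cs.selfadj B" using S' S by (simp add: is_adjoint_def B_def)
  have D: "K.cs.selfadj D" using S' S T' T by (simp add: is_adjoint_def D_def K.cs.ip_simps)
  have form: "ipK x (D x) = ipH (S' x) (S' x) - ipE (T' x) (T' x)" for x
    by (simp add: D_def K.cs.ip_simps S T)
  have nonnegT: "nonneg (ipE (T' x) (T' x))" and nonnegS: "nonneg (ipH (S' x) (S' x))" for x
    using assms(1,2) hilbert_module_nonneg by blast+
  have "op_positive ipK D \<longleftrightarrow> (\<forall>x. norm (T' x) \<le> norm (S' x))"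
  proof (intro iffI allI)
    fix x assume "op_positive ipK D"
    then have "nonneg (ipK x (D x))" by (rule K.nonneg_ip_of_op_positive)
    then have "norm (ipE (T' x) (T' x)) \<le> norm (ipE (T' x) (T' x) + ipK x (D x))"
      by (intro norm_le_norm_add nonnegT)
    then have "(norm (T' x))\<^sup>2 \<le> (norm (S' x))\<^sup>2"
      by (simp add: form E.norm_ip_self H.norm_ip_self)
    then show "norm (T' x) \<le> norm (S' x)" by (rule power2_le_imp_le) simp
  next
    assume le: "\<forall>x. norm (T' x) \<le> norm (S' x)"
    interpret B: bounded_linear B by (rule K.cs.selfadj_bounded_linear) fact
    define m where "m = onorm B + 1"
    have m: "m > 0" using onorm_pos_le[OF B.bounded_linear_axioms] by (simp add: m_def)
    have contr: "norm ((1 / m) *\<^sub>R B x) \<le> norm x" for x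
    proof -
      have "norm (B x) \<le> m * norm x"
        using onorm[OF B.bounded_linear_axioms, of x] by (simp add: m_def distrib_right add_increasing2)
      then show ?thesis using m by (simp add: field_simps)
    qed
    have sa: "K.cs.selfadj (\<lambda>x. (1 / m) *\<^sub>R B x)"
      using B by (simp add: is_adjoint_def K.cs.ip_simps)
    show "op_positive ipK D"
    proof (rule K.cs.op_positive_of_bounded_below[OF D])
      fix l :: real assume l: "l > 0"
      have "l / (m / l + 1) * norm x \<le> norm (D x + l *\<^sub>R x)" for x
      proof (cases "x = 0")
        case False
        define q where "q = ipH (S' x) (S' x)"
        define p where "p = ipE (T' x) (T' x)"
        define r where "r = ipK x x"
        define e where "e = norm x * norm (D x + l *\<^sub>R x)"
        have pq: "norm p \<le> norm q"
          using le power_mono[of "norm (T' x)" "norm (S' x)" 2]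
          by (simp add: p_def q_def E.norm_ip_self H.norm_ip_self)
        have "ipK x (D x + l *\<^sub>R x) = (q + l *\<^sub>R r) - p"
          by (simp add: K.cs.ip_simps form p_def q_def r_def)
        then have "norm ((q + l *\<^sub>R r) - p) \<le> e"
          using K.cs.norm_ip_le[of x "D x + l *\<^sub>R x"] by (simp add: e_def)
        then have upper: "norm (q + l *\<^sub>R r) \<le> norm q + e"
          using norm_triangle_sub[of "q + l *\<^sub>R r" p] pq by simp
        have "nonneg (r - (1 / m) *\<^sub>R q)"
          using K.nonneg_ip_diff_contraction[OF sa contr, of x]
          by (simp add: r_def q_def K.cs.ip_simps B_def S)
        then have "norm ((1 + l / m) *\<^sub>R q) \<le> norm ((1 + l / m) *\<^sub>R q + l *\<^sub>R (r - (1 / m) *\<^sub>R q))"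
          using l m nonnegS[of x] unfolding q_def by (intro norm_le_norm_add nonneg_scaleR) auto
        also have "(1 + l / m) *\<^sub>R q + l *\<^sub>R (r - (1 / m) *\<^sub>R q) = q + l *\<^sub>R r"
          by (simp add: algebra_simps)
        finally have "(1 + l / m) * norm q \<le> norm (q + l *\<^sub>R r)" using l m by simp
        with upper have "l / m * norm q \<le> e" by (simp add: distrib_right)
        then have q_le: "norm q \<le> m / l * e" using l m by (simp add: field_simps)
        have "norm (l *\<^sub>R r) \<le> norm (l *\<^sub>R r + q)"
          using l nonnegS[of x] K.nonneg_ip_self[of x] unfolding q_def r_def
          by (intro norm_le_norm_add nonneg_scaleR) auto
        also have "\<dots> \<le> norm q + e" using upper by (simp add: add.commute)
        also have "\<dots> \<le> (m / l + 1) * e" using q_le by (simp add: distrib_right)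
        finally have "norm x * (l * norm x) \<le> norm x * ((m / l + 1) * norm (D x + l *\<^sub>R x))"
          using l by (simp add: r_def e_def K.cs.norm_ip_self power2_eq_square mult_ac)
        then have "l * norm x \<le> (m / l + 1) * norm (D x + l *\<^sub>R x)" using False by simp
        moreover have "m / l + 1 > 0" using l m by (simp add: add_pos_pos)
        ultimately show ?thesis by (simp add: pos_divide_le_eq mult.commute)
      qed simp
      moreover have "l / (m / l + 1) > 0" using l m by (simp add: add_pos_pos)
      ultimately show "\<exists>\<delta>>0. \<forall>x. \<delta> * norm x \<le> norm (D x + l *\<^sub>R x)" by blast
    qed
  qed
  then show ?thesis by (simp add: op_le_def adj D_def[abs_def])
qed

end
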